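(* Let $p\equiv 1\pmod 6$ be a prime and let $a$ be an integer with $p\nmid a$. The sum of the abscissae of the rational points $(x,y)\in\mathbb{F}_p\times\mathbb{F}_p$ on the curve $y^{2}\equiv x^{3}+a^{3}\pmod p$, each point contributing its abscissa $x$ once, is $$\sum_{x\in\mathbb{F}_p}\bigl(1+\chi_p(x^{3}+a^{3})\bigr)\,x,$$ where elements $x\in\mathbb{F}_p$ are represented by the integers $0,1,\dots,p-1$ and the sums are sums of integers.
   Context: $\chi_p(t)$ is the Legendre symbol modulo $p$: it equals $+1$ if $p\nmid t$ and $t$ is a square modulo $p$, $0$ if $p\mid t$, and $-1$ if $t$ is not a square modulo $p$. The abscissa of an affine point $(x,y)$ is $x$; the point at infinity has no abscissa and does not contribute. *)

theory Defs
  imports "HOL-Number_Theory.Number_Theory"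
begin

text \<open>
  The affine points over the field with \<open>p\<close> elements of the curve \<open>y\<^sup>2 = x\<^sup>3 + a\<^sup>3\<close>.
  Residue classes are represented by the integers from \<open>0\<close> to \<open>p - 1\<close>, so a coordinate can be
  read off directly as an integer; the point at infinity is not included.
\<close>
definition curve_points :: "int \<Rightarrow> int \<Rightarrow> (int \<times> int) set" where
  "curve_points p a = {(x, y) \<in> {0..<p} \<times> {0..<p}. [y^2 = x^3 + a^3] (mod p)}"

end

theory Submission
  imports Defs
begin

text \<open>
  Sorting the affine points by abscissa, the sum counts each \<open>x\<close> as often as there are points
  above it, that is, as often as \<open>x\<^sup>3 + a\<^sup>3\<close> has square roots modulo \<open>p\<close>. For odd \<open>p\<close> the number of
  square roots of \<open>c\<close> is \<open>1 + \<chi>\<^sub>p(c)\<close>, which is the lemma \<open>card_square_roots_mod_prime\<close>: two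
  roots \<open>y\<close> and \<open>-y\<close> if \<open>c\<close> is a nonzero square, the root \<open>0\<close> if \<open>c\<close> vanishes, and none otherwise.
  A prime \<open>p \<equiv> 1 (mod 6)\<close> is odd, so the count applies.
\<close>

lemma cong_power2_iff_prime:
  fixes p y z :: int
  assumes "prime p"
  shows "[y\<^sup>2 = z\<^sup>2] (mod p) \<longleftrightarrow> [y = z] (mod p) \<or> [y = - z] (mod p)"
proof -
  have "y\<^sup>2 - z\<^sup>2 = (y - z) * (y + z)"
    by (simp add: power2_eq_square algebra_simps)
  then show ?thesis
    using assms by (simp add: cong_iff_dvd_diff prime_dvd_mult_iff)
qed

text \<open>
  Since the residues modulo a prime form a field, a single square root determines all of them up
  to sign. Oddness of the modulus is what keeps the roots \<open>y\<close> and \<open>-y\<close> of a nonzero \<open>c\<close> apart.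
\<close>
lemma card_square_roots_mod_prime:
  fixes p c :: int
  assumes p: "prime p" and odd: "odd p"
  shows "int (card {y \<in> {0..<p}. [y\<^sup>2 = c] (mod p)}) = 1 + Legendre c p"
proof (cases "QuadRes p c")
  case False
  then have empty: "{y \<in> {0..<p}. [y\<^sup>2 = c] (mod p)} = {}"
    by (auto simp: QuadRes_def)
  \<comment> \<open>Zero is a square, so a non-square falls into the last case of the Legendre symbol.\<close>
  have "\<not> [c = 0] (mod p)"
  proof
    assume "[c = 0] (mod p)"
    then have "[0\<^sup>2 = c] (mod p)" by (simp add: cong_def)
    then have "QuadRes p c" unfolding QuadRes_def by (rule exI)
    with False show False ..
  qed
  with False show ?thesis
    unfolding empty by (simp add: Legendre_def)
next
  case True
  then obtain z where z: "[z\<^sup>2 = c] (mod p)"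
    by (auto simp: QuadRes_def)
  have pos: "p > 0" using p by (simp add: prime_gt_0_int)
  have sqrt_iff: "[y\<^sup>2 = c] (mod p) \<longleftrightarrow> [y = z] (mod p) \<or> [y = - z] (mod p)" for y
    using cong_power2_iff_prime[OF p, of y z] z by (simp add: cong_def)
  have mod_iff: "y \<in> {0..<p} \<and> [y = w] (mod p) \<longleftrightarrow> y = w mod p" for y w
    using pos by (auto simp add: cong_def)
  have roots: "{y \<in> {0..<p}. [y\<^sup>2 = c] (mod p)} = {z mod p, (- z) mod p}"
    unfolding sqrt_iff using mod_iff by blast
  \<comment> \<open>The two roots coincide iff \<open>2z\<close> vanishes, which for odd \<open>p\<close> means that \<open>c\<close> does.\<close>
  have "z mod p = (- z) mod p \<longleftrightarrow> p dvd 2 * z"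
    by (simp add: mod_eq_dvd_iff)
  also have "\<dots> \<longleftrightarrow> p dvd z"
    using odd by (simp add: coprime_dvd_mult_right_iff)
  also have "\<dots> \<longleftrightarrow> [z\<^sup>2 = 0] (mod p)"
    using p by (simp add: cong_0_iff prime_dvd_power_iff)
  also have "\<dots> \<longleftrightarrow> [c = 0] (mod p)"
    using z by (simp add: cong_def)
  finally have "z mod p = (- z) mod p \<longleftrightarrow> [c = 0] (mod p)" .
  with True show ?thesis
    unfolding roots by (simp add: Legendre_def card_insert_if)
qed

theorem theorem5:
  fixes p a :: int
  assumes "prime p"
    and "[p = 1] (mod 6)"
    and "\<not> p dvd a"
  shows "(\<Sum>(x, y) \<in> curve_points p a. x)
       = (\<Sum>x \<in> {0..<p}. (1 + Legendre (x^3 + a^3) p) * x)"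
proof -
  define R where "R x = {y \<in> {0..<p}. [y\<^sup>2 = x^3 + a^3] (mod p)}" for x
  have "odd p"
    using assms(2) unfolding cong_def by presburger
  then have card_R: "int (card (R x)) = 1 + Legendre (x^3 + a^3) p" for x
    unfolding R_def using assms(1) by (rule card_square_roots_mod_prime[rotated])
  have fibres: "curve_points p a = Sigma {0..<p} R"
    by (auto simp: curve_points_def R_def)
  have finite_R: "finite (R x)" for x
    by (rule finite_subset[of _ "{0..<p}"]) (auto simp: R_def)
  have "(\<Sum>(x, y) \<in> curve_points p a. x) = (\<Sum>x \<in> {0..<p}. \<Sum>y \<in> R x. x)"
    unfolding fibres by (rule sum.Sigma[symmetric]) (simp_all add: finite_R)
  also have "\<dots> = (\<Sum>x \<in> {0..<p}. (1 + Legendre (x^3 + a^3) p) * x)"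
    by (simp add: card_R)
  finally show ?thesis .
qed

end
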